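(* Let $n\ge 1$ and let $R_0$ be the $(n+1)$-dimensional complex solvable Leibniz algebra with basis $\{e_0,e_1,\dots,e_n\}$ and multiplication $$[e_i,e_1]=e_{i+1}\ \ (0\le i\le n-1),\qquad [e_i,e_0]=-i\,e_i\ \ (1\le i\le n),$$ all other products of basis elements being zero. A linear map $\varphi:R_0\to R_0$ is an automorphism of $R_0$ if and only if there exist $\alpha,\beta\in\mathbb{C}$ with $\beta\neq 0$ such that $$\varphi(e_i)=\sum_{j=i}^n \frac{\alpha^{j-i}\beta^{i}}{(j-i)!}\,e_j,\qquad 0\le i\le n.$$
   Context: All algebras are over $\mathbb{C}$. A Leibniz algebra is a vector space $L$ with a bilinear product $[-,-]$ satisfying $[[x,y],z]=[[x,z],y]+[x,[y,z]]$ for all $x,y,z\in L$ (the product need not be antisymmetric). In multiplication tables, products of basis elements that are not listed are zero. An automorphism of $L$ is a bijective linear map $\varphi:L\to L$ with $\varphi([u,v])=[\varphi(u),\varphi(v)]$ for all $u,v\in L$. Convention: $t^0=1$ for every $t\in\mathbb{C}$, including $t=0$. *)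

theory Defs
  imports "HOL-Analysis.Analysis"
begin

text \<open>The vector space is an arbitrary type with an explicit scalar multiplication, as in
  \<^theory>\<open>HOL.Vector_Spaces\<close>, so that its dimension can be an ordinary natural number.\<close>

locale bilinear_algebra = vector_space scale
  for scale :: "complex \<Rightarrow> 'a::ab_group_add \<Rightarrow> 'a" +
  fixes br :: "'a \<Rightarrow> 'a \<Rightarrow> 'a"
  assumes linear_br_right: "Vector_Spaces.linear scale scale (\<lambda>y. br x y)"
    and linear_br_left: "Vector_Spaces.linear scale scale (\<lambda>x. br x y)"
begin

definition automorphism :: "('a \<Rightarrow> 'a) \<Rightarrow> bool" where
  "automorphism \<phi> \<longleftrightarrow> Vector_Spaces.linear scale scale \<phi> \<and> bij \<phi> \<and>
     (\<forall>u v. \<phi> (br u v) = br (\<phi> u) (\<phi> v))"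

fun derived :: "nat \<Rightarrow> 'a set" where
  "derived 0 = UNIV"
| "derived (Suc k) = span {br x y | x y. x \<in> derived k \<and> y \<in> derived k}"

definition solvable :: bool where
  "solvable \<longleftrightarrow> (\<exists>k. derived k = {0})"

lemma br_simps:
  "br (x + y) z = br x z + br y z" "br x (y + z) = br x y + br x z"
  "br (scale c x) z = scale c (br x z)" "br x (scale c z) = scale c (br x z)"
  "br 0 z = 0" "br x 0 = 0"
proof -
  show "br (x + y) z = br x z + br y z" "br x (y + z) = br x y + br x z"
    "br (scale c x) z = scale c (br x z)" "br x (scale c z) = scale c (br x z)" for x y z c
    using linear_br_left[of z] linear_br_right[of x] by (simp_all add: Vector_Spaces.linear_iff)
  from this(3)[of 0 0 z] this(4)[of x 0 0] show "br 0 z = 0" "br x 0 = 0"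
    by simp_all
qed

lemma br_span:
  assumes "x \<in> span A" "y \<in> span B" "\<And>a b. a \<in> A \<Longrightarrow> b \<in> B \<Longrightarrow> br a b \<in> span C"
  shows "br x y \<in> span C"
proof -
  have *: "br a y \<in> span C" if "a \<in> A" for a
    using assms(2)
  proof (induction rule: span_induct_alt)
    case base
    show ?case by (simp add: br_simps span_zero)
  next
    case (step c b z)
    then show ?case using assms(3) that by (simp add: br_simps span_add span_scale)
  qed
  show ?thesis
    using assms(1)
  proof (induction rule: span_induct_alt)
    case base
    show ?case by (simp add: br_simps span_zero)
  next
    case (step c b z)
    then show ?case using * by (simp add: br_simps span_add span_scale)
  qed
qed

end

locale leibniz_algebra = bilinear_algebra +
  assumes leibniz: "br (br x y) z = br (br x z) y + br x (br y z)"

text \<open>The algebra \<open>R\<^sub>0\<close>, presented by its basis \<open>e 0, \<dots>, e n\<close> and its multiplication table. That it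
  is a Leibniz algebra and solvable follows from the table, as proved below. The values of \<open>e\<close>
  beyond \<open>n\<close> are irrelevant.\<close>

locale R0_algebra = bilinear_algebra +
  fixes n :: nat and e :: "nat \<Rightarrow> 'a"
  assumes inj_e: "inj_on e {0..n}"
    and independent_e: "independent (e ` {0..n})"
    and span_e: "span (e ` {0..n}) = UNIV"
    and br_e1: "i < n \<Longrightarrow> br (e i) (e 1) = e (i + 1)"
    and br_e0: "1 \<le> i \<Longrightarrow> i \<le> n \<Longrightarrow> br (e i) (e 0) = scale (- of_nat i) (e i)"
    and br_other: "i \<le> n \<Longrightarrow> j \<le> n \<Longrightarrow> \<not> (j = 1 \<and> i < n) \<Longrightarrow> \<not> (j = 0 \<and> 1 \<le> i) \<Longrightarrow>
      br (e i) (e j) = 0"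
begin

lemma br_e:
  assumes "i \<le> n" "j \<le> n"
  shows "br (e i) (e j) = (if j = 1 \<and> i < n then e (i + 1)
    else if j = 0 then scale (- of_nat i) (e i) else 0)"
  using assms br_e1[of i] br_e0[of i] br_other[of i j] by (cases "i = 0") auto

lemma leibniz_e:
  assumes "i \<le> n" "j \<le> n" "k \<le> n"
  shows "br (br (e i) (e j)) (e k) = br (br (e i) (e k)) (e j) + br (e i) (br (e j) (e k))"
proof -
  have split: "m = 0 \<or> m = 1 \<or> m \<ge> 2" for m :: nat by linarith
  have minus: "br x (- y) = - br x y" for x y
    using br_simps(4)[of x "- 1" y] by simp
  have dist: "scale (- 1 - of_nat i) v = scale (- of_nat i) v - v" "scale (- 1) v = - v" for v
    by (simp_all add: scale_left_diff_distrib)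
  show ?thesis
    using split[of j] split[of k] assms
    by (elim disjE) (simp_all add: br_e br_simps minus dist del: scale_minus_left)
qed

sublocale leibniz_algebra
proof
  fix x y z
  let ?P = "\<lambda>x y z. br (br x y) z = br (br x z) y + br x (br y z)"
  have U: "v \<in> span (e ` {0..n})" for v by (simp add: span_e)
  have 1: "?P (e i) (e j) z" if "i \<le> n" "j \<le> n" for i j z
    using U[of z]
  proof (induction rule: span_induct_alt)
    case base
    show ?case by (simp add: br_simps)
  next
    case (step c b v)
    then obtain k where k: "b = e k" "k \<le> n" by auto
    have P: "?P (e i) (e j) b"
      unfolding k(1) by (rule leibniz_e[OF that k(2)])
    show ?case
      by (simp only: br_simps P step.IH scale_right_distrib add_ac)
  qed
  have 2: "?P (e i) y z" if "i \<le> n" for i y z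
    using U[of y]
  proof (induction rule: span_induct_alt)
    case base
    show ?case by (simp add: br_simps)
  next
    case (step c b v)
    then obtain k where k: "b = e k" "k \<le> n" by auto
    have P: "?P (e i) b z"
      unfolding k(1) by (rule 1[OF that k(2)])
    show ?case
      by (simp only: br_simps P step.IH scale_right_distrib add_ac)
  qed
  show "?P x y z"
    using U[of x]
  proof (induction rule: span_induct_alt)
    case base
    show ?case by (simp add: br_simps)
  next
    case (step c b v)
    then obtain k where k: "b = e k" "k \<le> n" by auto
    have P: "?P b y z"
      unfolding k(1) by (rule 2[OF k(2)])
    show ?case
      by (simp only: br_simps P step.IH scale_right_distrib add_ac)
  qed
qed

lemma solvable: "solvable"
proof -
  have 1: "derived 1 \<subseteq> span (e ` {1..n})"
  proof -
    have "br x y \<in> span (e ` {1..n})" for x y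
    proof (rule br_span[of _ "e ` {0..n}" _ "e ` {0..n}"])
      fix a b assume "a \<in> e ` {0..n}" "b \<in> e ` {0..n}"
      then obtain i j where ij: "a = e i" "b = e j" "i \<le> n" "j \<le> n" by auto
      have "scale (- of_nat i) (e i) \<in> span (e ` {1..n})"
        by (cases "i = 0") (use ij in \<open>auto intro!: span_scale[OF span_base] simp: span_zero
          simp del: scale_minus_left\<close>)
      then show "br a b \<in> span (e ` {1..n})"
        using ij by (auto simp: br_e span_zero intro!: span_base[OF imageI])
    qed (simp_all add: span_e)
    then have "{br x y | x y. x \<in> derived 0 \<and> y \<in> derived 0} \<subseteq> span (e ` {1..n})" by blast
    from span_minimal[OF this] show ?thesis by simp
  qed
  have 2: "derived 2 \<subseteq> span (e ` {2..n})"
  proof -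
    have "br x y \<in> span (e ` {2..n})"
      if "x \<in> span (e ` {1..n})" "y \<in> span (e ` {1..n})" for x y
      using that
    proof (rule br_span)
      fix a b assume "a \<in> e ` {1..n}" "b \<in> e ` {1..n}"
      then show "br a b \<in> span (e ` {2..n})"
        by (auto simp: br_e span_zero intro!: span_base[OF imageI])
    qed
    with 1 have "{br x y | x y. x \<in> derived 1 \<and> y \<in> derived 1} \<subseteq> span (e ` {2..n})" by auto
    from span_minimal[OF this] show ?thesis by (simp add: numeral_2_eq_2)
  qed
  have 3: "derived 3 \<subseteq> span {}"
  proof -
    have "br x y \<in> span {}"
      if "x \<in> span (e ` {2..n})" "y \<in> span (e ` {2..n})" for x y
      using that
    proof (rule br_span)
      fix a b assume "a \<in> e ` {2..n}" "b \<in> e ` {2..n}"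
      then show "br a b \<in> span {}"
        by (auto simp: br_e)
    qed
    with 2 have "{br x y | x y. x \<in> derived 2 \<and> y \<in> derived 2} \<subseteq> span {}" by blast
    from span_minimal[OF this] show ?thesis by (simp add: numeral_3_eq_3 numeral_2_eq_2)
  qed
  have "0 \<in> derived 3" by (simp add: numeral_3_eq_3 span_zero)
  with 3 have "derived 3 = {0}" by auto
  then show ?thesis unfolding solvable_def by blast
qed

end

text \<open>The presentation is realised in every dimension.\<close>

lemma R0_algebra_exists:
  assumes "CARD('i::finite) = n + 1" "1 \<le> n"
  shows "\<exists>br e. R0_algebra ((*s) :: complex \<Rightarrow> complex ^ 'i \<Rightarrow> complex ^ 'i) br n e"
proof -
  have "\<exists>f. bij_betw f {0..n} (UNIV :: 'i set)"
    by (rule finite_same_card_bij) (use assms in auto)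
  then obtain f where f: "bij_betw f {0..n} (UNIV :: 'i set)" by blast
  define m where "m = inv_into {0..n} f"
  have mf: "m (f i) = i" if "i \<le> n" for i
    unfolding m_def using f that by (auto simp: bij_betw_def)
  have fm: "f (m k) = k" "m k \<le> n" for k
    unfolding m_def using f f_inv_into_f[of k f "{0..n}"] inv_into_into[of k f "{0..n}"]
    by (auto simp: bij_betw_def)
  have f_eq: "f i = k \<longleftrightarrow> i = m k" if "i \<le> n" for i k
    using mf fm that by metis
  define br :: "complex ^ 'i \<Rightarrow> complex ^ 'i \<Rightarrow> complex ^ 'i" where
    "br x y = (\<chi> k. (if m k \<ge> 1 then x $ f (m k - 1) * y $ f 1 else 0)
       - of_nat (m k) * x $ k * y $ f 0)" for x y
  define e :: "nat \<Rightarrow> complex ^ 'i" where "e i = axis (f i) 1" for i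
  have e_nth: "e i $ k = (if i = m k then 1 else 0)" if "i \<le> n" for i k
    using f_eq[OF that, of k] by (auto simp: e_def axis_def)
  have e_cart: "e ` {0..n} = cart_basis"
  proof -
    have "e ` {0..n} = (\<lambda>k. axis k 1) ` (f ` {0..n})" by (simp add: e_def image_image)
    also have "f ` {0..n} = UNIV" using f by (simp add: bij_betw_def)
    finally show ?thesis by (auto simp: cart_basis_def)
  qed
  have "R0_algebra (*s) br n e"
  proof (intro R0_algebra.intro bilinear_algebra.intro bilinear_algebra_axioms.intro
      R0_algebra_axioms.intro)
    show "vector_space ((*s) :: complex \<Rightarrow> complex ^ 'i \<Rightarrow> complex ^ 'i)"
      by (rule vec.vector_space_axioms)
    show "Vector_Spaces.linear (*s) (*s) (\<lambda>y. br x y)" for x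
      using vec.vector_space_axioms
      by (auto simp: Vector_Spaces.linear_iff br_def vec_eq_iff algebra_simps)
    show "Vector_Spaces.linear (*s) (*s) (\<lambda>x. br x y)" for y
      using vec.vector_space_axioms
      by (auto simp: Vector_Spaces.linear_iff br_def vec_eq_iff algebra_simps)
    show "inj_on e {0..n}"
      by (rule inj_onI) (metis atLeastAtMost_iff e_def axis_eq_axis mf zero_neq_one)
    show "vec.independent (e ` {0..n})" "vec.span (e ` {0..n}) = UNIV"
      unfolding e_cart by (simp_all add: independent_cart_basis)
    have m_pred: "m (f (m k - 1)) = m k - 1" for k
      using mf[of "m k - 1"] fm(2)[of k] by simp
    show "br (e i) (e 1) = e (i + 1)" if "i < n" for i
      using that assms(2) by (auto simp: vec_eq_iff br_def e_nth mf m_pred[unfolded One_nat_def])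
    show "br (e i) (e 0) = - of_nat i *s e i" if "1 \<le> i" "i \<le> n" for i
      using that assms(2) by (auto simp: vec_eq_iff br_def e_nth mf m_pred[unfolded One_nat_def])
    show "br (e i) (e j) = 0"
      if "i \<le> n" "j \<le> n" "\<not> (j = 1 \<and> i < n)" "\<not> (j = 0 \<and> 1 \<le> i)" for i j
    proof -
      have "br (e i) (e j) $ k = 0" for k
      proof -
        have "(if m k \<ge> 1 then e i $ f (m k - 1) * e j $ f 1 else 0) = 0"
        proof (cases "m k \<ge> 1 \<and> j = 1")
          case True
          then have "m k - 1 \<noteq> i" using that fm(2)[of k] by linarith
          then show ?thesis using that by (simp add: e_nth m_pred[unfolded One_nat_def])
        next
          case False
          then show ?thesis using that assms(2) by (auto simp: e_nth mf)
        qed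
        moreover have "of_nat (m k) * e i $ k * e j $ f 0 = 0"
          using that by (auto simp: e_nth mf)
        ultimately show ?thesis by (simp add: br_def)
      qed
      then show ?thesis by (simp add: vec_eq_iff)
    qed
  qed
  then show ?thesis by blast
qed

end

theory Submission
  imports Defs
begin

text \<open>In coordinates, the bracket with \<open>y\<close> on the right depends only on the coordinates \<open>y\<^sub>0, y\<^sub>1\<close>:
  \<open>[x, y]\<^sub>k = x\<^bsub>k-1\<^esub> y\<^sub>1 - k x\<^sub>k y\<^sub>0\<close>. Let \<open>\<phi>\<close> be an automorphism, \<open>a = \<phi>(e\<^sub>0)\<close> and \<open>b = \<phi>(e\<^sub>1)\<close>. As a
  bracket, \<open>b\<close> has \<open>b\<^sub>0 = 0\<close>, and \<open>b\<^sub>1 \<noteq> 0\<close> since otherwise \<open>b = [a, b] = 0\<close>. Then \<open>[b, a] = -b\<close> gives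
  \<open>a\<^sub>0 = 1\<close>, and \<open>[a, a] = 0\<close> becomes the recursion \<open>k a\<^sub>k = a\<^sub>1 a\<^bsub>k-1\<^esub>\<close>, while
  \<open>\<phi>(e\<^bsub>i+1\<^esub>) = [\<phi>(e\<^sub>i), b]\<close> is \<open>b\<^sub>1\<close> times the shift of \<open>\<phi>(e\<^sub>i)\<close>. Hence \<open>\<alpha> = a\<^sub>1\<close> and \<open>\<beta> = b\<^sub>1\<close>.
  Conversely such maps respect the bracket on basis elements and are triangular with nonzero
  diagonal.\<close>

context R0_algebra
begin

text \<open>Meaningful only for \<open>k\<close> \<le> \<open>n\<close>, since the values of
  \<open>e\<close> beyond \<open>n\<close> are unconstrained.\<close>

definition coord :: "nat \<Rightarrow> 'a \<Rightarrow> complex" where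
  "coord k x = representation (e ` {0..n}) x (e k)"

lemma coord_add: "coord k (x + y) = coord k x + coord k y"
  unfolding coord_def by (simp add: representation_add independent_e span_e)

lemma coord_scale: "coord k (scale c x) = c * coord k x"
  unfolding coord_def by (simp add: representation_scale independent_e span_e)

lemma coord_zero: "coord k 0 = 0"
  unfolding coord_def by (simp add: representation_zero)

lemma coord_sum: "coord k (sum f A) = (\<Sum>i\<in>A. coord k (f i))"
  by (induction A rule: infinite_finite_induct) (simp_all add: coord_add coord_zero)

lemma coord_e:
  assumes "i \<le> n" "k \<le> n"
  shows "coord k (e i) = (if k = i then 1 else 0)"
  using assms inj_onD[OF inj_e, of k i]
  by (auto simp: coord_def representation_basis independent_e)

lemma coord_sum_e:
  assumes "k \<le> n"
  shows "coord k (\<Sum>j=i..n. scale (f j) (e j)) = (if i \<le> k then f k else 0)"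
proof -
  have "coord k (\<Sum>j=i..n. scale (f j) (e j)) = (\<Sum>j=i..n. if k = j then f j else 0)"
    unfolding coord_sum
    by (rule sum.cong) (auto simp: coord_scale coord_e assms)
  also have "\<dots> = (if i \<le> k then f k else 0)" using assms by simp
  finally show ?thesis .
qed

text \<open>Reduces identities linear in a vector to the basis elements.\<close>

lemma e_induct [case_names zero step]:
  assumes "P 0" "\<And>c i x. i \<le> n \<Longrightarrow> P x \<Longrightarrow> P (scale c (e i) + x)"
  shows "P x"
proof -
  have "x \<in> span (e ` {0..n})" by (simp add: span_e)
  then show ?thesis
    by (induction rule: span_induct_alt) (use assms in auto)
qed

lemma sum_coord: "(\<Sum>k=0..n. scale (coord k x) (e k)) = x"
proof (induction x rule: e_induct)
  case zero
  show ?case by (simp add: coord_zero)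
next
  case (step c i x)
  have "(\<Sum>k=0..n. scale (coord k (scale c (e i) + x)) (e k))
      = (\<Sum>k=0..n. if k = i then scale c (e k) else 0) + (\<Sum>k=0..n. scale (coord k x) (e k))"
    unfolding sum.distrib[symmetric]
    by (rule sum.cong) (use step in \<open>auto simp: coord_add coord_scale coord_e scale_left_distrib\<close>)
  with step show ?case by simp
qed

lemma coord_eqI:
  assumes "\<And>k. k \<le> n \<Longrightarrow> coord k x = coord k y"
  shows "x = y"
proof -
  have "(\<Sum>k=0..n. scale (coord k x) (e k)) = (\<Sum>k=0..n. scale (coord k y) (e k))"
    by (rule sum.cong) (use assms in auto)
  then show ?thesis by (simp add: sum_coord)
qed

text \<open>Both sides are linear in \<open>x\<close> and in \<open>y\<close>, so two nested
  inductions reduce the claim to the multiplication table. The split at \<open>k = 0\<close> keeps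
  the truncated \<open>k - 1\<close> from adding a spurious term.\<close>

lemma coord_br:
  assumes "1 \<le> n" "k \<le> n"
  shows "coord k (br x y) =
    (if k = 0 then 0 else coord (k - 1) x * coord 1 y) - of_nat k * coord k x * coord 0 y"
proof (induction x rule: e_induct)
  case zero
  show ?case by (simp add: br_simps coord_zero)
next
  case (step c i x)
  have "coord k (br (e i) y) =
    (if k = 0 then 0 else coord (k - 1) (e i) * coord 1 y) - of_nat k * coord k (e i) * coord 0 y"
  proof (induction y rule: e_induct)
    case zero
    show ?case by (simp add: br_simps coord_zero)
  next
    case (step d j y)
    have "coord k (br (e i) (e j)) =
      (if k = 0 then 0 else coord (k - 1) (e i) * coord 1 (e j))
        - of_nat k * coord k (e i) * coord 0 (e j)"
      using assms step(1) \<open>i \<le> n\<close>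
      by (auto simp: br_e coord_e coord_scale coord_zero simp del: scale_minus_left)
    with step(2) show ?case
      by (simp add: br_simps coord_add coord_scale) (simp add: algebra_simps)
  qed
  with step(2) show ?case
    by (simp add: br_simps coord_add coord_scale) (simp add: algebra_simps)
qed

lemma automorphism_imp_formula:
  assumes n: "1 \<le> n" and "automorphism \<phi>"
  shows "\<exists>\<alpha> \<beta>. \<beta> \<noteq> 0 \<and>
    (\<forall>i\<le>n. \<phi> (e i) = (\<Sum>j=i..n. scale (\<alpha> ^ (j - i) * \<beta> ^ i / fact (j - i)) (e j)))"
proof -
  have lin: "Vector_Spaces.linear scale scale \<phi>" and bij: "bij \<phi>"
    and hom: "\<phi> (br u v) = br (\<phi> u) (\<phi> v)" for u v
    using assms(2) by (auto simp: automorphism_def)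
  interpret \<phi>: Vector_Spaces.linear scale scale \<phi> by (rule lin)
  define a where "a = \<phi> (e 0)"
  define b where "b = \<phi> (e 1)"
  have ab: "br a b = b"
    using hom[of "e 0" "e 1"] n by (simp add: a_def b_def br_e)
  have ba: "br b a = scale (- 1) b"
    using hom[of "e 1" "e 0"] n by (simp add: a_def b_def br_e \<phi>.neg)
  have aa: "br a a = 0"
    using hom[of "e 0" "e 0"] n by (simp add: a_def br_e \<phi>.zero)
  have b0: "coord 0 b = 0"
    using coord_br[OF n, of 0 a b] by (simp add: ab)
  have b1: "coord 1 b \<noteq> 0"
  proof
    assume "coord 1 b = 0"
    with b0 have "coord k (br a b) = coord k 0" if "k \<le> n" for k
      using coord_br[OF n that, of a b] by (simp add: coord_zero)
    then have "b = 0" unfolding ab by (rule coord_eqI)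
    \<comment> \<open>Injectivity of \<open>\<phi>\<close> carries \<open>b = 0\<close> back to
      \<open>e 1\<close>, whose coordinate 1 is 1.\<close>
    then have "e 1 = 0" using bij \<phi>.zero by (metis b_def bij_is_inj injD)
    with coord_e[OF n n] show False by (simp add: coord_zero)
  qed
  \<comment> \<open>Coordinate 1 of \<open>[b, a] = -b\<close> reads
    \<open>b\<^sub>0 a\<^sub>1 - b\<^sub>1 a\<^sub>0 = -b\<^sub>1\<close>, where
    \<open>b\<^sub>0 = 0\<close> and \<open>b\<^sub>1\<close> can be cancelled.\<close>
  have a0: "coord 0 a = 1"
    using coord_br[OF n n, of b a] b1 by (simp add: ba b0 coord_scale del: scale_minus_left)
  have ak: "coord k a = coord 1 a ^ k / fact k" if "k \<le> n" for k
    using that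
  proof (induction k)
    case 0
    show ?case by (simp add: a0)
  next
    case (Suc k)
    have "of_nat (Suc k) * coord (Suc k) a = coord k a * coord 1 a"
      using coord_br[OF n Suc.prems, of a a] by (simp add: aa a0 coord_zero del: of_nat_Suc)
    then have "coord (Suc k) a = coord k a * coord 1 a / of_nat (Suc k)"
      by (simp add: field_simps del: of_nat_Suc)
    with Suc show ?case by (simp add: mult.commute)
  qed
  \<comment> \<open>Induction on \<open>i\<close> with \<open>k\<close> arbitrary, since each step
    refers to coordinate \<open>k - 1\<close>; the base case is \<open>ak\<close>.\<close>
  have "coord k (\<phi> (e i)) =
      (if i \<le> k then coord 1 a ^ (k - i) * coord 1 b ^ i / fact (k - i) else 0)"
    if "i \<le> n" "k \<le> n" for i k
    using that
  proof (induction i arbitrary: k)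
    case 0
    then show ?case by (simp add: ak flip: a_def)
  next
    case (Suc i)
    have "\<phi> (e (Suc i)) = br (\<phi> (e i)) b"
      using hom[of "e i" "e 1"] Suc.prems n by (simp add: b_def br_e)
    with coord_br[OF n Suc.prems(2), of "\<phi> (e i)" b]
    have "coord k (\<phi> (e (Suc i))) = (if k = 0 then 0 else coord (k - 1) (\<phi> (e i)) * coord 1 b)"
      by (simp add: b0)
    with Suc show ?case by (cases k) auto
  qed
  then have "\<phi> (e i) =
      (\<Sum>j=i..n. scale (coord 1 a ^ (j - i) * coord 1 b ^ i / fact (j - i)) (e j))"
    if "i \<le> n" for i
    using that by (intro coord_eqI) (simp add: coord_sum_e)
  with b1 show ?thesis by blast
qed

text \<open>Back substitution from \<open>e n\<close> downwards gives surjectivity, which in finite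
  dimension implies injectivity.\<close>

lemma triangular_imp_bij:
  assumes lin: "Vector_Spaces.linear scale scale \<phi>"
    and triangular: "\<And>i. i \<le> n \<Longrightarrow> \<phi> (e i) = (\<Sum>j=i..n. scale (c i j) (e j))"
    and diagonal: "\<And>i. i \<le> n \<Longrightarrow> c i i \<noteq> 0"
  shows "bij \<phi>"
proof -
  interpret \<phi>: Vector_Spaces.linear scale scale \<phi> by (rule lin)
  interpret fin: finite_dimensional_vector_space scale "e ` {0..n}"
    by unfold_locales (simp_all add: independent_e span_e)
  have sub: "subspace (range \<phi>)"
    using \<phi>.subspace_image[OF subspace_UNIV] by simp
  have mem: "e i \<in> range \<phi>" if "i \<le> n" for i
    using that
  proof (induction "n - i" arbitrary: i rule: less_induct)
    case less
    \<comment> \<open>The tail involves only indices above \<open>i\<close>, already in the range by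
      induction; removing it from \<open>\<phi> (e i)\<close> leaves a nonzero multiple of
      \<open>e i\<close>.\<close>
    let ?s = "\<Sum>j=Suc i..n. scale (c i j) (e j)"
    have "?s \<in> range \<phi>"
      by (rule subspace_sum[OF sub]) (use less in \<open>auto intro!: subspace_scale[OF sub]\<close>)
    then have "\<phi> (e i) - ?s \<in> range \<phi>" by (intro subspace_diff[OF sub]) auto
    moreover have "\<phi> (e i) - ?s = scale (c i i) (e i)"
      using triangular[OF less.prems] by (simp add: sum.atLeast_Suc_atMost less.prems)
    ultimately have "scale (inverse (c i i)) (scale (c i i) (e i)) \<in> range \<phi>"
      by (metis subspace_scale[OF sub])
    then show ?case using diagonal[OF less.prems] by simp
  qed
  have "span (e ` {0..n}) \<subseteq> range \<phi>"
    by (rule span_minimal[OF _ sub]) (use mem in auto)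
  then have "surj \<phi>" by (auto simp: span_e)
  with fin.linear_surj_imp_inj[OF lin] show ?thesis by (simp add: bij_def)
qed

lemma formula_imp_automorphism:
  assumes n: "1 \<le> n" and lin: "Vector_Spaces.linear scale scale \<phi>" and \<beta>: "\<beta> \<noteq> 0"
    and formula: "\<And>i. i \<le> n \<Longrightarrow>
      \<phi> (e i) = (\<Sum>j=i..n. scale (\<alpha> ^ (j - i) * \<beta> ^ i / fact (j - i)) (e j))"
  shows "automorphism \<phi>"
proof -
  interpret \<phi>: Vector_Spaces.linear scale scale \<phi> by (rule lin)
  \<comment> \<open>The diagonal coefficients are \<open>\<beta> ^ i\<close>.\<close>
  have bij: "bij \<phi>"
    using \<beta> by (intro triangular_imp_bij[OF lin formula]) auto
  have coord_\<phi>: "coord k (\<phi> (e i)) =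
      (if i \<le> k then \<alpha> ^ (k - i) * \<beta> ^ i / fact (k - i) else 0)" if "i \<le> n" "k \<le> n" for i k
    using that by (simp add: formula coord_sum_e)
  have hom_e: "\<phi> (br (e i) (e j)) = br (\<phi> (e i)) (\<phi> (e j))" if ij: "i \<le> n" "j \<le> n" for i j
  proof (rule coord_eqI)
    fix k assume k: "k \<le> n"
    note br = coord_br[OF n k, of "\<phi> (e i)" "\<phi> (e j)"]
    consider "j = 0" | "j = 1" | "j \<ge> 2" by linarith
    then show "coord k (\<phi> (br (e i) (e j))) = coord k (br (\<phi> (e i)) (\<phi> (e j)))"
    proof cases
      case 1
      have lhs: "coord k (\<phi> (br (e i) (e j))) = - of_nat i * coord k (\<phi> (e i))"
        using 1 ij n by (simp add: br_e \<phi>.scale coord_scale del: scale_minus_left)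
      consider "k < i" | "k = i" | m where "k = i + Suc m"
        by (metis less_iff_Suc_add linorder_neqE_nat add_Suc_right)
      then show ?thesis
      proof cases
        case 3
        define x where "x = \<alpha> ^ Suc m * \<beta> ^ i / fact (Suc m)"
        have "\<alpha> ^ m * \<beta> ^ i / fact m * \<alpha> = of_nat (Suc m) * x"
          by (simp add: x_def field_simps del: of_nat_Suc)
        moreover have "coord (k - 1) (\<phi> (e i)) = \<alpha> ^ m * \<beta> ^ i / fact m"
          "coord k (\<phi> (e i)) = x" "coord 1 (\<phi> (e j)) = \<alpha>" "coord 0 (\<phi> (e j)) = 1"
          using 1 3 k ij n by (simp_all add: coord_\<phi> x_def)
        ultimately show ?thesis
          unfolding lhs br using 3 by (simp add: algebra_simps)
      qed (use lhs br 1 k ij n in \<open>auto simp: coord_\<phi>\<close>)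
    next
      case 2
      have rhs: "coord k (br (\<phi> (e i)) (\<phi> (e j))) =
          (if k = 0 then 0 else coord (k - 1) (\<phi> (e i)) * \<beta>)"
        unfolding br using 2 n by (simp add: coord_\<phi>)
      show ?thesis
      proof (cases "i < n")
        case True
        then show ?thesis
          unfolding rhs using 2 n k by (cases k) (auto simp: br_e coord_\<phi>)
      next
        \<comment> \<open>Here \<open>i = n\<close>: \<open>\<phi> (e n)\<close> is a multiple of
          \<open>e n\<close>, and the shift pushes it past the last coordinate.\<close>
        case False
        then show ?thesis
          unfolding rhs using 2 n k ij by (cases k) (auto simp: br_e coord_\<phi> \<phi>.zero coord_zero)
      qed
    next
      \<comment> \<open>Now \<open>\<phi> (e j)\<close> starts at index 2 or later, so its
        coordinates 0 and 1 vanish and both brackets are zero.\<close>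
      case 3
      then show ?thesis
        unfolding br using ij n by (simp add: br_e coord_\<phi> \<phi>.zero coord_zero)
    qed
  qed
  \<comment> \<open>Bilinearity extends \<open>hom_e\<close> to all vectors, first in the right
    argument and then in the left.\<close>
  have hom_e_left: "\<phi> (br (e i) v) = br (\<phi> (e i)) (\<phi> v)" if "i \<le> n" for i v
    by (induction v rule: e_induct)
      (use that in \<open>simp_all add: br_simps \<phi>.zero \<phi>.add \<phi>.scale hom_e\<close>)
  have "\<phi> (br u v) = br (\<phi> u) (\<phi> v)" for u v
    by (induction u rule: e_induct)
      (simp_all add: br_simps \<phi>.zero \<phi>.add \<phi>.scale hom_e_left)
  with lin bij show ?thesis by (simp add: automorphism_def)
qed

end

theorem theorem0p3p1:
  fixes scale :: "complex \<Rightarrow> 'a::ab_group_add \<Rightarrow> 'a"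
    and br :: "'a \<Rightarrow> 'a \<Rightarrow> 'a" and n :: nat and e :: "nat \<Rightarrow> 'a" and \<phi> :: "'a \<Rightarrow> 'a"
  assumes "1 \<le> n"
    and "R0_algebra scale br n e"
    and "Vector_Spaces.linear scale scale \<phi>"
  shows "bilinear_algebra.automorphism scale br \<phi> \<longleftrightarrow>
    (\<exists>\<alpha> \<beta> :: complex. \<beta> \<noteq> 0 \<and>
      (\<forall>i\<le>n. \<phi> (e i) = (\<Sum>j=i..n. scale (\<alpha> ^ (j - i) * \<beta> ^ i / fact (j - i)) (e j))))"
proof -
  interpret R0_algebra scale br n e by (rule assms(2))
  show ?thesis
    using automorphism_imp_formula[OF assms(1)] formula_imp_automorphism[OF assms(1,3)] by blast
qed

end
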